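(* For every LTS $\mathcal{L}\in\mathcal{A}(N)$: (1) $\mathsf{toFW}(\mathcal{L})\in\mathcal{M}(N)$; (2) if $N=\emptyset$ then $\mathsf{toFW}(\mathcal{L})$ is isomorphic to $\mathcal{L}$.
   Context: $\mathsf{Act}$ is a countable set of visible actions, $\tau\notin\mathsf{Act}$, $\mathsf{L}=\mathsf{Act}\cup\{\tau\}$, $\mu\mapsto\overline{\mu}$ an involutive duality on $\mathsf{Act}$; $N\subseteq\mathsf{Act}$ is a (possibly empty) set of non-blocking actions. LTSs are $(S,\to,\mathsf{L})$. Axioms (for all $\alpha\in\mathsf{L}$, $\eta\in N$, $\mu\in\mathsf{Act}$, $\mu\neq\eta$): N-delay: $p_1\xrightarrow{\eta}p_2\xrightarrow{\alpha}p_3\Rightarrow\exists p_4.\,p_1\xrightarrow{\alpha}p_4\xrightarrow{\eta}p_3$; N-confluence: $p_1\xrightarrow{\eta}p_2$, $p_1\xrightarrow{\mu}p_3\Rightarrow\exists p_4.\,p_2\xrightarrow{\mu}p_4,\ p_3\xrightarrow{\eta}p_4$; N-determinacy: $p_1\xrightarrow{\eta}p_2,p_1\xrightarrow{\eta}p_3\Rightarrow p_2=p_3$; backwards-N-determinacy: $p_2\xrightarrow{\eta}p_1,p_3\xrightarrow{\eta}p_1\Rightarrow p_2=p_3$; Fwd-Feedback: $p_1\xrightarrow{\eta}p_2\xrightarrow{\overline{\eta}}p_3\Rightarrow p_1\xrightarrow{\tau}p_3$ or $p_1=p_3$; Boomerang: every $p$ has $p'$ with $p\xrightarrow{\overline{\eta}}p'\xrightarrow{\eta}p$;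 N-tau: $p_1\xrightarrow{\eta}p_2$, $p_1\xrightarrow{\tau}p_3$ imply $\exists p_4.\,p_2\xrightarrow{\tau}p_4,\ p_3\xrightarrow{\eta}p_4$, or $p_2\xrightarrow{\overline{\eta}}p_3$; Feedback: $p\xrightarrow{\eta}q\xrightarrow{\overline{\eta}}q'\Rightarrow p\xrightarrow{\tau}q'$. $\mathcal{M}(N)$: LTSs satisfying N-delay, N-confluence, N-determinacy, backwards-N-determinacy, Fwd-Feedback, Boomerang, N-tau. $\mathcal{A}(N)$: LTSs satisfying N-delay, N-confluence, N-determinacy, backwards-N-determinacy, N-tau, Feedback. $MO$ is the set of finite multisets over $N$, with transitions $M\xrightarrow{\overline{\eta}}_m M\uplus\{\eta\}$ and $M\uplus\{\eta\}\xrightarrow{\eta}_m M$ for $\eta\in N$. For $\mathcal{L}$ with states $X$, $\mathsf{toFW}(\mathcal{L})$ has states $X\times MO$ and transitions: $(p,M)\xrightarrow{\alpha}(p',M)$ if $p\xrightarrow{\alpha}p'$; $(p,M)\xrightarrow{\alpha}(p,M')$ if $M\xrightarrow{\alpha}_m M'$; $(p,M)\xrightarrow{\tau}(p',M')$ if $p\xrightarrow{\overline{\eta}}p'$ and $M\xrightarrow{\eta}_m M'$ for some $\eta\in N$.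
   Formalization: With literal equality of pairs, (1) fails once L has an N-transition; so in N-determinacy, backwards-N-determinacy and Fwd-Feedback for toFW(L), "=" is read as the least equivalence relating s to (q,M⊎{η}) whenever s –η→ (q,M), η∈N. The other axioms and (2) are literal. *)

theory Defs
  imports Main "HOL-Library.Countable" "HOL-Library.Multiset"
begin

text \<open>The visible actions are the elements of the type \<open>'a\<close> (of class \<open>countable\<close> in the theorem).\<close>

datatype 'a label = Tau | Vis 'a

record ('s, 'a) lts =
  states :: "'s set"
  step :: "'s \<Rightarrow> 'a label \<Rightarrow> 's \<Rightarrow> bool"

definition wf_lts :: "('s, 'a) lts \<Rightarrow> bool" where
  "wf_lts L \<longleftrightarrow> (\<forall>p \<alpha> q. step L p \<alpha> q \<longrightarrow> p \<in> states L \<and> q \<in> states L)"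

definition isomorphic :: "('s, 'a) lts \<Rightarrow> ('t, 'a) lts \<Rightarrow> bool" where
  "isomorphic L K \<longleftrightarrow> (\<exists>f. bij_betw f (states L) (states K) \<and>
     (\<forall>p\<in>states L. \<forall>q\<in>states L. \<forall>\<alpha>. step L p \<alpha> q \<longleftrightarrow> step K (f p) \<alpha> (f q)))"

text \<open>
  Three axioms compare states with \<open>=\<close>; they take as parameter the relation \<open>E\<close> that is used as
  equality of states.
\<close>

definition N_delay :: "'a set \<Rightarrow> ('s, 'a) lts \<Rightarrow> bool" where
  "N_delay N L \<longleftrightarrow> (\<forall>\<eta>\<in>N. \<forall>\<alpha> p1 p2 p3. step L p1 (Vis \<eta>) p2 \<and> step L p2 \<alpha> p3 \<longrightarrow>
     (\<exists>p4. step L p1 \<alpha> p4 \<and> step L p4 (Vis \<eta>) p3))"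

definition N_confluence :: "'a set \<Rightarrow> ('s, 'a) lts \<Rightarrow> bool" where
  "N_confluence N L \<longleftrightarrow> (\<forall>\<eta>\<in>N. \<forall>\<mu> p1 p2 p3.
     \<mu> \<noteq> \<eta> \<and> step L p1 (Vis \<eta>) p2 \<and> step L p1 (Vis \<mu>) p3 \<longrightarrow>
     (\<exists>p4. step L p2 (Vis \<mu>) p4 \<and> step L p3 (Vis \<eta>) p4))"

definition N_determinacy :: "('s \<Rightarrow> 's \<Rightarrow> bool) \<Rightarrow> 'a set \<Rightarrow> ('s, 'a) lts \<Rightarrow> bool" where
  "N_determinacy E N L \<longleftrightarrow> (\<forall>\<eta>\<in>N. \<forall>p1 p2 p3.
     step L p1 (Vis \<eta>) p2 \<and> step L p1 (Vis \<eta>) p3 \<longrightarrow> E p2 p3)"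

definition backwards_N_determinacy :: "('s \<Rightarrow> 's \<Rightarrow> bool) \<Rightarrow> 'a set \<Rightarrow> ('s, 'a) lts \<Rightarrow> bool" where
  "backwards_N_determinacy E N L \<longleftrightarrow> (\<forall>\<eta>\<in>N. \<forall>p1 p2 p3.
     step L p2 (Vis \<eta>) p1 \<and> step L p3 (Vis \<eta>) p1 \<longrightarrow> E p2 p3)"

definition fwd_feedback ::
  "('a \<Rightarrow> 'a) \<Rightarrow> ('s \<Rightarrow> 's \<Rightarrow> bool) \<Rightarrow> 'a set \<Rightarrow> ('s, 'a) lts \<Rightarrow> bool" where
  "fwd_feedback dual E N L \<longleftrightarrow> (\<forall>\<eta>\<in>N. \<forall>p1 p2 p3.
     step L p1 (Vis \<eta>) p2 \<and> step L p2 (Vis (dual \<eta>)) p3 \<longrightarrow> step L p1 Tau p3 \<or> E p1 p3)"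

definition boomerang :: "('a \<Rightarrow> 'a) \<Rightarrow> 'a set \<Rightarrow> ('s, 'a) lts \<Rightarrow> bool" where
  "boomerang dual N L \<longleftrightarrow> (\<forall>\<eta>\<in>N. \<forall>p\<in>states L.
     \<exists>p'. step L p (Vis (dual \<eta>)) p' \<and> step L p' (Vis \<eta>) p)"

definition N_tau :: "('a \<Rightarrow> 'a) \<Rightarrow> 'a set \<Rightarrow> ('s, 'a) lts \<Rightarrow> bool" where
  "N_tau dual N L \<longleftrightarrow> (\<forall>\<eta>\<in>N. \<forall>p1 p2 p3.
     step L p1 (Vis \<eta>) p2 \<and> step L p1 Tau p3 \<longrightarrow>
     (\<exists>p4. step L p2 Tau p4 \<and> step L p3 (Vis \<eta>) p4) \<or> step L p2 (Vis (dual \<eta>)) p3)"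

definition feedback :: "('a \<Rightarrow> 'a) \<Rightarrow> 'a set \<Rightarrow> ('s, 'a) lts \<Rightarrow> bool" where
  "feedback dual N L \<longleftrightarrow> (\<forall>\<eta>\<in>N. \<forall>p q q'.
     step L p (Vis \<eta>) q \<and> step L q (Vis (dual \<eta>)) q' \<longrightarrow> step L p Tau q')"

definition class_A ::
  "('a \<Rightarrow> 'a) \<Rightarrow> ('s \<Rightarrow> 's \<Rightarrow> bool) \<Rightarrow> 'a set \<Rightarrow> ('s, 'a) lts set" where
  "class_A dual E N = {L. wf_lts L \<and> N_delay N L \<and> N_confluence N L \<and> N_determinacy E N L \<and>
     backwards_N_determinacy E N L \<and> N_tau dual N L \<and> feedback dual N L}"

definition class_M ::
  "('a \<Rightarrow> 'a) \<Rightarrow> ('s \<Rightarrow> 's \<Rightarrow> bool) \<Rightarrow> 'a set \<Rightarrow> ('s, 'a) lts set" where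
  "class_M dual E N = {L. wf_lts L \<and> N_delay N L \<and> N_confluence N L \<and> N_determinacy E N L \<and>
     backwards_N_determinacy E N L \<and> fwd_feedback dual E N L \<and> boomerang dual N L \<and>
     N_tau dual N L}"

definition MO :: "'a set \<Rightarrow> 'a multiset set" where
  "MO N = {M. set_mset M \<subseteq> N}"

inductive MO_trans :: "('a \<Rightarrow> 'a) \<Rightarrow> 'a set \<Rightarrow> 'a multiset \<Rightarrow> 'a label \<Rightarrow> 'a multiset \<Rightarrow> bool"
  for dual :: "'a \<Rightarrow> 'a" and N :: "'a set" where
  insert: "\<eta> \<in> N \<Longrightarrow> M \<in> MO N \<Longrightarrow> MO_trans dual N M (Vis (dual \<eta>)) (M + {#\<eta>#})"
| remove: "\<eta> \<in> N \<Longrightarrow> M \<in> MO N \<Longrightarrow> MO_trans dual N (M + {#\<eta>#}) (Vis \<eta>) M"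

inductive FW_trans ::
  "('a \<Rightarrow> 'a) \<Rightarrow> 'a set \<Rightarrow> ('s, 'a) lts \<Rightarrow> 's \<times> 'a multiset \<Rightarrow> 'a label \<Rightarrow> 's \<times> 'a multiset \<Rightarrow> bool"
  for dual :: "'a \<Rightarrow> 'a" and N :: "'a set" and L :: "('s, 'a) lts" where
  proc: "step L p \<alpha> p' \<Longrightarrow> M \<in> MO N \<Longrightarrow> FW_trans dual N L (p, M) \<alpha> (p', M)"
| mem: "p \<in> states L \<Longrightarrow> MO_trans dual N M \<alpha> M' \<Longrightarrow> FW_trans dual N L (p, M) \<alpha> (p, M')"
| sync: "\<eta> \<in> N \<Longrightarrow> step L p (Vis (dual \<eta>)) p' \<Longrightarrow> MO_trans dual N M (Vis \<eta>) M' \<Longrightarrow>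
    FW_trans dual N L (p, M) Tau (p', M')"

definition toFW :: "('a \<Rightarrow> 'a) \<Rightarrow> 'a set \<Rightarrow> ('s, 'a) lts \<Rightarrow> ('s \<times> 'a multiset, 'a) lts" where
  "toFW dual N L = \<lparr>states = states L \<times> MO N, step = FW_trans dual N L\<rparr>"

text \<open>
  Equality of states of \<open>toFW\<close>. If \<open>p\<close> performs \<open>\<eta>\<close> and becomes \<open>q\<close>, then the message \<open>\<eta>\<close> may be
  held by the process, as in \<open>(p, M)\<close>, or by the buffer, as in \<open>(q, M + {#\<eta>#})\<close>; the two pairs
  denote the same state. \<open>FW_eq\<close> is the least equivalence with this property, applied to all
  \<open>\<eta>\<close>-transitions of \<open>toFW\<close>: for those that remove \<open>\<eta>\<close> from the buffer it says nothing, and the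
  remaining ones (insertions of \<open>dual \<eta>\<close>) exist only if both \<open>\<eta>\<close> and \<open>dual \<eta>\<close> are in \<open>N\<close>. If that
  never happens and \<open>L\<close> is in \<open>class_A dual (=) N\<close>, then \<open>FW_eq\<close> is a strong bisimulation.

  Equality of pairs cannot be meant in the axioms of \<open>class_M\<close>: by
  \<open>toFW_not_syntactically_determinate\<close> it makes \<open>N_determinacy\<close> fail for \<open>toFW dual N L\<close>
  as soon as \<open>L\<close> has a single transition with a label in \<open>N\<close>.
\<close>

definition FW_eq ::
  "('a \<Rightarrow> 'a) \<Rightarrow> 'a set \<Rightarrow> ('s, 'a) lts \<Rightarrow> 's \<times> 'a multiset \<Rightarrow> 's \<times> 'a multiset \<Rightarrow> bool" where
  "FW_eq dual N L = equivclp (\<lambda>s t. \<exists>\<eta>\<in>N. \<exists>q M.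
     step (toFW dual N L) s (Vis \<eta>) (q, M) \<and> t = (q, M + {#\<eta>#}))"

lemma toFW_not_syntactically_determinate:
  assumes "wf_lts L" "\<eta> \<in> N" "step L p (Vis \<eta>) q"
  shows "\<not> N_determinacy (=) N (toFW dual N L)"
proof -
  have mo: "{#\<eta>#} \<in> MO N" "{#} \<in> MO N" using assms(2) by (auto simp: MO_def)
  have "p \<in> states L" using assms by (auto simp: wf_lts_def)
  then have "step (toFW dual N L) (p, {#\<eta>#}) (Vis \<eta>) (p, {#})"
    using MO_trans.remove[OF assms(2) mo(2), of dual] by (auto simp: toFW_def intro: FW_trans.mem)
  moreover have "step (toFW dual N L) (p, {#\<eta>#}) (Vis \<eta>) (q, {#\<eta>#})"
    using assms(3) mo(1) by (auto simp: toFW_def intro: FW_trans.proc)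
  ultimately show ?thesis using assms(2) unfolding N_determinacy_def by fastforce
qed

lemma FW_eq_empty: "FW_eq dual {} L = (=)"
proof (intro ext iffI)
  fix s t assume "FW_eq dual {} L s t"
  then show "s = t" unfolding FW_eq_def by (induction rule: equivclp_induct) auto
qed (simp add: FW_eq_def)

end

theory Submission
  imports Defs
begin

text \<open>
  The buffer alone satisfies \<open>N_delay\<close>, and two of its transitions from the same state either join
  or coincide. An axiom for \<open>toFW\<close> then splits into transitions in different components, which
  commute, and transitions in the same component, where the axiom of the process or the
  corresponding property of the buffer applies. When \<open>\<eta>\<close> and \<open>dual \<eta>\<close> are both in \<open>N\<close>, the label
  \<open>\<eta>\<close> also inserts \<open>dual \<eta>\<close>, so that a synchronisation may enlarge the buffer; the axioms survive
  this because removal of \<open>\<eta>\<close> and insertion of \<open>dual \<eta>\<close> differ only by the pair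
  \<open>{#\<eta>, dual \<eta>#}\<close>, which \<open>FW_eq\<close> identifies with the empty buffer.
\<close>

section \<open>Transitions of the buffer alone\<close>

lemma add_mset_in_MO [simp]: "add_mset \<eta> M \<in> MO N \<longleftrightarrow> \<eta> \<in> N \<and> M \<in> MO N"
  by (auto simp: MO_def)

lemma MO_trans_in_MO: "MO_trans dual N M \<alpha> M' \<Longrightarrow> M \<in> MO N \<and> M' \<in> MO N"
  by (auto elim!: MO_trans.cases)

lemma not_MO_trans_Tau [simp]: "\<not> MO_trans dual N M Tau M'"
  by (auto elim: MO_trans.cases)

text \<open>By the involution, the rule for insertion read at label \<mu> inserts
  \<open>dual \<mu>\<close>. Its side condition on the message is absorbed by membership of the
  larger multiset in \<open>MO N\<close>.\<close>

lemma MO_trans_Vis_iff: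
  assumes "\<forall>\<mu>. dual (dual \<mu>) = \<mu>"
  shows "MO_trans dual N M (Vis \<mu>) M' \<longleftrightarrow> M \<in> MO N \<and> M' \<in> MO N \<and>
    (M = add_mset \<mu> M' \<or> M' = add_mset (dual \<mu>) M)"
proof
  assume "MO_trans dual N M (Vis \<mu>) M'"
  then show "M \<in> MO N \<and> M' \<in> MO N \<and> (M = add_mset \<mu> M' \<or> M' = add_mset (dual \<mu>) M)"
    using assms by (auto elim!: MO_trans.cases)
next
  assume "M \<in> MO N \<and> M' \<in> MO N \<and> (M = add_mset \<mu> M' \<or> M' = add_mset (dual \<mu>) M)"
  then show "MO_trans dual N M (Vis \<mu>) M'"
    using MO_trans.remove[of \<mu> N M' dual] MO_trans.insert[of "dual \<mu>" N M dual] assms by auto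
qed

lemma MO_trans_delay:
  assumes dual: "\<forall>\<mu>. dual (dual \<mu>) = \<mu>" and "\<eta> \<in> N"
    and "MO_trans dual N M1 (Vis \<eta>) M2" "MO_trans dual N M2 \<alpha> M3"
  shows "\<exists>M4. MO_trans dual N M1 \<alpha> M4 \<and> MO_trans dual N M4 (Vis \<eta>) M3"
proof (cases \<alpha>)
  case Tau
  then show ?thesis using assms by simp
next
  case (Vis \<mu>)
  note iff = MO_trans_Vis_iff[OF dual]
  have steps: "MO_trans dual N M1 (Vis \<eta>) M2" "MO_trans dual N M2 (Vis \<mu>) M3"
    using assms Vis by auto
  consider (remove) "M1 = add_mset \<eta> M2"
    | (insert_insert) "M2 = add_mset (dual \<eta>) M1" "M3 = add_mset (dual \<mu>) M2"
    | (insert_remove) "M2 = add_mset (dual \<eta>) M1" "M2 = add_mset \<mu> M3"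
    using steps unfolding iff by blast
  then show ?thesis
  proof cases
    case remove
    \<comment> \<open>The second move ignores \<eta>, so \<eta> can stay in the buffer until
      afterwards.\<close>
    then have "MO_trans dual N M1 \<alpha> (add_mset \<eta> M3) \<and> MO_trans dual N (add_mset \<eta> M3) (Vis \<eta>) M3"
      using steps \<open>\<eta> \<in> N\<close> unfolding Vis iff by auto
    then show ?thesis ..
  next
    case insert_insert
    then have "MO_trans dual N M1 \<alpha> (add_mset (dual \<mu>) M1) \<and>
        MO_trans dual N (add_mset (dual \<mu>) M1) (Vis \<eta>) M3"
      using steps unfolding Vis iff by auto
    then show ?thesis ..
  next
    case insert_remove
    \<comment> \<open>Either the message just inserted is taken out again, or one that was already
      in \<open>M1\<close>.\<close>
    then consider "\<mu> = dual \<eta>" "M3 = M1"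
      | X where "M1 = add_mset \<mu> X" "M3 = add_mset (dual \<eta>) X"
      by (metis add_eq_conv_ex)
    then show ?thesis
    proof cases
      case 1
      \<comment> \<open>The detour through \<open>dual \<eta>\<close> is replaced by one through
        \<eta>: label \<open>dual \<eta>\<close> inserts \<eta>, and label \<eta> removes
        it.\<close>
      then have "MO_trans dual N M1 \<alpha> (add_mset \<eta> M1) \<and>
          MO_trans dual N (add_mset \<eta> M1) (Vis \<eta>) M3"
        using steps dual \<open>\<eta> \<in> N\<close> unfolding Vis iff by auto
      then show ?thesis ..
    next
      case 2
      then have "MO_trans dual N M1 \<alpha> X \<and> MO_trans dual N X (Vis \<eta>) M3"
        using steps unfolding Vis iff by auto
      then show ?thesis ..
    qed
  qed
qed

text \<open>Moves on different messages commute. Equal labels are allowed as long as the targets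
  differ; one move then removes \<eta> and the other inserts \<open>dual \<eta>\<close>. The
  delicate case of \<open>N_tau_toFW\<close> relies on this.\<close>

lemma MO_trans_join:
  assumes dual: "\<forall>\<mu>. dual (dual \<mu>) = \<mu>"
    and "MO_trans dual N M1 (Vis \<eta>) M2" "MO_trans dual N M1 (Vis \<mu>) M3"
    and neq: "\<not> (\<eta> = \<mu> \<and> M2 = M3)"
  shows "\<exists>M4. MO_trans dual N M2 (Vis \<mu>) M4 \<and> MO_trans dual N M3 (Vis \<eta>) M4"
proof -
  note iff = MO_trans_Vis_iff[OF dual]
  note steps = assms(2,3)[unfolded iff]
  consider (remove_remove) "M1 = add_mset \<eta> M2" "M1 = add_mset \<mu> M3"
    | (remove_insert) "M1 = add_mset \<eta> M2" "M3 = add_mset (dual \<mu>) M1"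
    | (insert_remove) "M2 = add_mset (dual \<eta>) M1" "M1 = add_mset \<mu> M3"
    | (insert_insert) "M2 = add_mset (dual \<eta>) M1" "M3 = add_mset (dual \<mu>) M1"
    using steps by blast
  then show ?thesis
  proof cases
    case remove_remove
    then obtain X where "M2 = add_mset \<mu> X" "M3 = add_mset \<eta> X"
      using neq by (metis add_eq_conv_ex)
    then have "MO_trans dual N M2 (Vis \<mu>) X \<and> MO_trans dual N M3 (Vis \<eta>) X"
      using steps unfolding iff by auto
    then show ?thesis ..
  next
    case remove_insert
    then have "MO_trans dual N M2 (Vis \<mu>) (add_mset (dual \<mu>) M2) \<and>
        MO_trans dual N M3 (Vis \<eta>) (add_mset (dual \<mu>) M2)"
      using steps unfolding iff by auto
    then show ?thesis ..
  next
    case insert_remove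
    then have "MO_trans dual N M2 (Vis \<mu>) (add_mset (dual \<eta>) M3) \<and>
        MO_trans dual N M3 (Vis \<eta>) (add_mset (dual \<eta>) M3)"
      using steps unfolding iff by auto
    then show ?thesis ..
  next
    case insert_insert
    then have "MO_trans dual N M2 (Vis \<mu>) (add_mset (dual \<mu>) M2) \<and>
        MO_trans dual N M3 (Vis \<eta>) (add_mset (dual \<mu>) M2)"
      using steps unfolding iff by auto
    then show ?thesis ..
  qed
qed

section \<open>Transitions of \<open>toFW\<close>, split by component\<close>

lemma step_toFW [simp]: "step (toFW dual N L) = FW_trans dual N L"
  by (simp add: toFW_def)

lemma FW_trans_Vis_iff:
  "FW_trans dual N L (p, M) (Vis \<mu>) (q, M') \<longleftrightarrow>
    step L p (Vis \<mu>) q \<and> M' = M \<and> M \<in> MO N \<or>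
    p \<in> states L \<and> q = p \<and> MO_trans dual N M (Vis \<mu>) M'"
  by (auto elim: FW_trans.cases intro: FW_trans.intros)

lemma FW_trans_Tau_iff:
  "FW_trans dual N L (p, M) Tau (q, M') \<longleftrightarrow>
    step L p Tau q \<and> M' = M \<and> M \<in> MO N \<or>
    (\<exists>\<eta>\<in>N. step L p (Vis (dual \<eta>)) q \<and> MO_trans dual N M (Vis \<eta>) M')"
  by (auto elim: FW_trans.cases intro: FW_trans.intros)

lemma wf_toFW: "wf_lts L \<Longrightarrow> wf_lts (toFW dual N L)"
  unfolding wf_lts_def
  by (auto simp: toFW_def elim!: FW_trans.cases dest: MO_trans_in_MO)

section \<open>Delay and confluence of \<open>toFW\<close>\<close>

lemma N_delay_toFW:
  assumes dual: "\<forall>\<mu>. dual (dual \<mu>) = \<mu>" and wf: "wf_lts L" and delay: "N_delay N L"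
  shows "N_delay N (toFW dual N L)"
  unfolding N_delay_def step_toFW
proof (intro ballI allI impI, elim conjE)
  fix \<eta> \<alpha> s1 s2 s3
  assume \<eta>: "\<eta> \<in> N" and first: "FW_trans dual N L s1 (Vis \<eta>) s2"
    and second: "FW_trans dual N L s2 \<alpha> s3"
  obtain p M q M' where s: "s1 = (p, M)" "s2 = (q, M')" by (metis surj_pair)
  consider (proc) "step L p (Vis \<eta>) q" "M' = M" "M \<in> MO N"
    | (mem) "p \<in> states L" "q = p" "MO_trans dual N M (Vis \<eta>) M'"
    using first unfolding s FW_trans_Vis_iff by blast
  then show "\<exists>s4. FW_trans dual N L s1 \<alpha> s4 \<and> FW_trans dual N L s4 (Vis \<eta>) s3"
  proof cases
    case proc
    have "p \<in> states L" using wf proc by (auto simp: wf_lts_def)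
    show ?thesis
      using second[unfolded s]
    proof cases
      case (proc r)
      then obtain p4 where "step L p \<alpha> p4" "step L p4 (Vis \<eta>) r"
        using delay \<eta> \<open>step L p (Vis \<eta>) q\<close> unfolding N_delay_def by blast
      then show ?thesis using proc s \<open>M' = M\<close> by (auto intro: FW_trans.proc)
    next
      case (mem M'')
      then have "FW_trans dual N L s1 \<alpha> (p, M'')" "FW_trans dual N L (p, M'') (Vis \<eta>) s3"
        using s proc \<open>p \<in> states L\<close> by (auto intro: FW_trans.intros dest: MO_trans_in_MO)
      then show ?thesis by blast
    next
      case (sync \<zeta> r M'')
      \<comment> \<open>Only the process half of the synchronisation, labelled
        \<open>dual \<zeta>\<close>, has to overtake \<eta>; the buffer half is unaffected.\<close>
      then obtain p4 where "step L p (Vis (dual \<zeta>)) p4" "step L p4 (Vis \<eta>) r"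
        using delay \<eta> \<open>step L p (Vis \<eta>) q\<close> unfolding N_delay_def by blast
      then have "FW_trans dual N L s1 \<alpha> (p4, M'')" "FW_trans dual N L (p4, M'') (Vis \<eta>) s3"
        using s proc sync by (auto intro: FW_trans.intros dest: MO_trans_in_MO)
      then show ?thesis by blast
    qed
  next
    case mem
    show ?thesis
      using second[unfolded s]
    proof cases
      case (proc r)
      then have "r \<in> states L" using wf by (auto simp: wf_lts_def)
      then have "FW_trans dual N L s1 \<alpha> (r, M)" "FW_trans dual N L (r, M) (Vis \<eta>) s3"
        using s mem proc by (auto intro: FW_trans.intros dest: MO_trans_in_MO)
      then show ?thesis by blast
    next
      case (mem M'')
      then obtain M4 where "MO_trans dual N M \<alpha> M4" "MO_trans dual N M4 (Vis \<eta>) M''"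
        using MO_trans_delay[OF dual \<eta> \<open>MO_trans dual N M (Vis \<eta>) M'\<close>] by blast
      then show ?thesis using s mem \<open>q = p\<close> by (auto intro: FW_trans.mem)
    next
      case (sync \<zeta> r M'')
      then have "r \<in> states L" using wf by (auto simp: wf_lts_def)
      \<comment> \<open>Here \<eta> is a buffer move, so the buffer half of the synchronisation
        overtakes it.\<close>
      obtain M4 where "MO_trans dual N M (Vis \<zeta>) M4" "MO_trans dual N M4 (Vis \<eta>) M''"
        using MO_trans_delay[OF dual \<eta> \<open>MO_trans dual N M (Vis \<eta>) M'\<close>] sync by blast
      then have "FW_trans dual N L s1 \<alpha> (r, M4)" "FW_trans dual N L (r, M4) (Vis \<eta>) s3"
        using s mem sync \<open>r \<in> states L\<close> by (auto intro: FW_trans.intros)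
      then show ?thesis by blast
    qed
  qed
qed

lemma N_confluence_toFW:
  assumes dual: "\<forall>\<mu>. dual (dual \<mu>) = \<mu>" and wf: "wf_lts L" and confl: "N_confluence N L"
  shows "N_confluence N (toFW dual N L)"
  unfolding N_confluence_def step_toFW
proof (intro ballI allI impI, elim conjE)
  fix \<eta> \<mu> s1 s2 s3
  assume \<eta>: "\<eta> \<in> N" and neq: "\<mu> \<noteq> \<eta>" and steps: "FW_trans dual N L s1 (Vis \<eta>) s2"
    "FW_trans dual N L s1 (Vis \<mu>) s3"
  obtain p M q M2 r M3 where s: "s1 = (p, M)" "s2 = (q, M2)" "s3 = (r, M3)"
    by (metis surj_pair)
  have in_states: "x \<in> states L" "y \<in> states L" if "step L x \<alpha> y" for x \<alpha> y
    using wf that by (auto simp: wf_lts_def)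
  consider (proc_proc) "step L p (Vis \<eta>) q" "step L p (Vis \<mu>) r" "M2 = M" "M3 = M" "M \<in> MO N"
    | (proc_mem) "step L p (Vis \<eta>) q" "r = p" "M2 = M" "MO_trans dual N M (Vis \<mu>) M3"
    | (mem_proc) "q = p" "step L p (Vis \<mu>) r" "MO_trans dual N M (Vis \<eta>) M2" "M3 = M"
    | (mem_mem) "p \<in> states L" "q = p" "r = p"
        "MO_trans dual N M (Vis \<eta>) M2" "MO_trans dual N M (Vis \<mu>) M3"
    using steps unfolding s FW_trans_Vis_iff by blast
  then show "\<exists>s4. FW_trans dual N L s2 (Vis \<mu>) s4 \<and> FW_trans dual N L s3 (Vis \<eta>) s4"
  proof cases
    case proc_proc
    then obtain p4 where "step L q (Vis \<mu>) p4" "step L r (Vis \<eta>) p4"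
      using confl \<eta> neq unfolding N_confluence_def by blast
    then show ?thesis using s proc_proc by (auto intro: FW_trans.proc)
  next
    case proc_mem
    then have "FW_trans dual N L s2 (Vis \<mu>) (q, M3) \<and> FW_trans dual N L s3 (Vis \<eta>) (q, M3)"
      using s in_states by (auto intro: FW_trans.intros dest: MO_trans_in_MO)
    then show ?thesis ..
  next
    case mem_proc
    then have "FW_trans dual N L s2 (Vis \<mu>) (r, M2) \<and> FW_trans dual N L s3 (Vis \<eta>) (r, M2)"
      using s in_states by (auto intro: FW_trans.intros dest: MO_trans_in_MO)
    then show ?thesis ..
  next
    case mem_mem
    then obtain M4 where "MO_trans dual N M2 (Vis \<mu>) M4" "MO_trans dual N M3 (Vis \<eta>) M4"
      using MO_trans_join[OF dual] neq by metis
    then show ?thesis using s mem_mem by (auto intro: FW_trans.mem)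
  qed
qed

section \<open>Equality of states and the two determinacy axioms\<close>

lemma FW_eq_refl [simp]: "FW_eq dual N L s s"
  by (simp add: FW_eq_def)

lemma FW_eq_sym: "FW_eq dual N L s t \<Longrightarrow> FW_eq dual N L t s"
  unfolding FW_eq_def by (rule equivclp_sym)

lemma FW_eq_trans [trans]: "FW_eq dual N L s t \<Longrightarrow> FW_eq dual N L t u \<Longrightarrow> FW_eq dual N L s u"
  unfolding FW_eq_def by (rule equivclp_trans)

lemma FW_eq_step:
  assumes "\<eta> \<in> N" "FW_trans dual N L s (Vis \<eta>) (q, M)"
  shows "FW_eq dual N L s (q, add_mset \<eta> M)"
  unfolding FW_eq_def by (rule r_into_equivclp) (use assms in auto)

text \<open>Inserting \<open>dual \<eta>\<close> is a transition with label \<eta>, so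
  \<open>FW_eq_step\<close> adds \<eta> to its target.\<close>

lemma FW_eq_dual_pair:
  assumes dual: "\<forall>\<mu>. dual (dual \<mu>) = \<mu>"
    and "\<eta> \<in> N" "dual \<eta> \<in> N" "p \<in> states L" "M \<in> MO N"
  shows "FW_eq dual N L (p, M) (p, add_mset \<eta> (add_mset (dual \<eta>) M))"
  using assms by (intro FW_eq_step) (auto simp: FW_trans_Vis_iff MO_trans_Vis_iff)

lemma N_determinacy_toFW:
  assumes dual: "\<forall>\<mu>. dual (dual \<mu>) = \<mu>" and wf: "wf_lts L" and det: "N_determinacy (=) N L"
  shows "N_determinacy (FW_eq dual N L) N (toFW dual N L)"
  unfolding N_determinacy_def step_toFW
proof (intro ballI allI impI, elim conjE)
  fix \<eta> s1 s2 s3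
  assume \<eta>: "\<eta> \<in> N" and steps: "FW_trans dual N L s1 (Vis \<eta>) s2" "FW_trans dual N L s1 (Vis \<eta>) s3"
  obtain p M q M2 r M3 where s: "s1 = (p, M)" "s2 = (q, M2)" "s3 = (r, M3)"
    by (metis surj_pair)
  \<comment> \<open>The mixed case: the process may still emit \<eta> from \<open>(p, M')\<close>,
    which makes that state equal to \<open>(q, add_mset \<eta> M')\<close>. This is
    \<open>(q, M)\<close> if the buffer removed \<eta>, and \<open>(q, M)\<close> plus a dual pair
    if it inserted \<open>dual \<eta>\<close>.\<close>
  have proc_mem_eq: "FW_eq dual N L (q, M) (p, M')"
    if steps: "step L p (Vis \<eta>) q" "MO_trans dual N M (Vis \<eta>) M'" for q M'
  proof -
    have in_states: "q \<in> states L" using wf that by (auto simp: wf_lts_def)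
    have MO: "M \<in> MO N" "M' \<in> MO N" using that by (auto dest: MO_trans_in_MO)
    have eq: "FW_eq dual N L (p, M') (q, add_mset \<eta> M')"
      using that MO \<eta> by (auto intro: FW_eq_step FW_trans.proc)
    consider "M = add_mset \<eta> M'" | "M' = add_mset (dual \<eta>) M" "dual \<eta> \<in> N"
      using steps MO unfolding MO_trans_Vis_iff[OF dual] by auto
    then show ?thesis
    proof cases
      case 1
      then show ?thesis using eq by (simp add: FW_eq_sym)
    next
      case 2
      then have "FW_eq dual N L (q, M) (q, add_mset \<eta> M')"
        using FW_eq_dual_pair[OF dual \<eta>] in_states MO by auto
      then show ?thesis using eq by (metis FW_eq_sym FW_eq_trans)
    qed
  qed
  consider (proc_proc) "step L p (Vis \<eta>) q" "step L p (Vis \<eta>) r" "M2 = M" "M3 = M"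
    | (proc_mem) "step L p (Vis \<eta>) q" "r = p" "M2 = M" "MO_trans dual N M (Vis \<eta>) M3"
    | (mem_proc) "q = p" "step L p (Vis \<eta>) r" "MO_trans dual N M (Vis \<eta>) M2" "M3 = M"
    | (mem_mem) "p \<in> states L" "q = p" "r = p"
        "MO_trans dual N M (Vis \<eta>) M2" "MO_trans dual N M (Vis \<eta>) M3"
    using steps unfolding s FW_trans_Vis_iff by blast
  then show "FW_eq dual N L s2 s3"
  proof cases
    case proc_proc
    then have "q = r" using det \<eta> unfolding N_determinacy_def by blast
    then show ?thesis using s proc_proc by simp
  next
    case proc_mem
    then show ?thesis using s proc_mem_eq by simp
  next
    case mem_proc
    then show ?thesis using s proc_mem_eq FW_eq_sym by blast
  next
    case mem_mem
    then have MO: "M \<in> MO N" "M2 \<in> MO N" "M3 \<in> MO N" by (auto dest: MO_trans_in_MO)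
    \<comment> \<open>Two different buffer moves with label \<eta> are a removal and an insertion,
      and their targets differ by a dual pair.\<close>
    consider "M2 = M3"
      | "M = add_mset \<eta> M2" "M3 = add_mset (dual \<eta>) M"
      | "M2 = add_mset (dual \<eta>) M" "M = add_mset \<eta> M3"
      using mem_mem unfolding MO_trans_Vis_iff[OF dual] by (metis add_mset_add_mset_same_iff)
    then show ?thesis
    proof cases
      case 1
      then show ?thesis using s mem_mem by simp
    next
      case 2
      then show ?thesis
        using s mem_mem MO FW_eq_dual_pair[OF dual \<eta>, of p L M2]
        by (simp add: add_mset_commute)
    next
      case 3
      then show ?thesis
        using s mem_mem MO FW_eq_dual_pair[OF dual \<eta>, of p L M3]
        by (simp add: add_mset_commute FW_eq_sym)
    qed
  qed
qed

text \<open>By \<open>FW_eq_step\<close>, all sources of \<eta>-transitions into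
  \<open>(q, M)\<close> equal \<open>(q, add_mset \<eta> M)\<close>.\<close>

lemma backwards_N_determinacy_toFW:
  "backwards_N_determinacy (FW_eq dual N L) N (toFW dual N L)"
  unfolding backwards_N_determinacy_def step_toFW
  by (metis FW_eq_step FW_eq_sym FW_eq_trans surj_pair)

section \<open>Feedback, boomerang and the axiom for \<tau>\<close>

lemma fwd_feedback_toFW:
  assumes dual: "\<forall>\<mu>. dual (dual \<mu>) = \<mu>" and feedback: "feedback dual N L"
  shows "fwd_feedback dual (FW_eq dual N L) N (toFW dual N L)"
  unfolding fwd_feedback_def step_toFW
proof (intro ballI allI impI, elim conjE)
  fix \<eta> s1 s2 s3
  assume \<eta>: "\<eta> \<in> N" and steps: "FW_trans dual N L s1 (Vis \<eta>) s2"
    "FW_trans dual N L s2 (Vis (dual \<eta>)) s3"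
  obtain p M q M2 r M3 where s: "s1 = (p, M)" "s2 = (q, M2)" "s3 = (r, M3)"
    by (metis surj_pair)
  note iff = MO_trans_Vis_iff[OF dual]
  consider (proc_proc) "step L p (Vis \<eta>) q" "step L q (Vis (dual \<eta>)) r"
        "M2 = M" "M3 = M" "M \<in> MO N"
    | (proc_mem) "step L p (Vis \<eta>) q" "r = q" "M2 = M" "MO_trans dual N M (Vis (dual \<eta>)) M3"
    | (mem_proc) "q = p" "step L p (Vis (dual \<eta>)) r" "MO_trans dual N M (Vis \<eta>) M2" "M3 = M2"
    | (mem_mem) "p \<in> states L" "q = p" "r = p"
        "MO_trans dual N M (Vis \<eta>) M2" "MO_trans dual N M2 (Vis (dual \<eta>)) M3"
    using steps unfolding s FW_trans_Vis_iff by blast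
  then show "FW_trans dual N L s1 Tau s3 \<or> FW_eq dual N L s1 s3"
  proof cases
    case proc_proc
    then have "step L p Tau r" using feedback \<eta> unfolding feedback_def by blast
    then show ?thesis using s proc_proc by (auto intro: FW_trans.proc)
  next
    case proc_mem
    \<comment> \<open>The buffer either consumes \<open>dual \<eta>\<close> against the \<eta> of
      the process, which is a synchronisation on \<open>dual \<eta>\<close>, or stores the emitted
      \<eta>, which leaves the state unchanged up to \<open>FW_eq\<close>.\<close>
    then consider "M = add_mset (dual \<eta>) M3" "dual \<eta> \<in> N" | "M3 = add_mset \<eta> M"
      using dual unfolding iff by auto
    then show ?thesis
    proof cases
      case 1
      then have "FW_trans dual N L s1 Tau s3"
        using s proc_mem dual FW_trans.sync[of "dual \<eta>" N L p dual q M M3] by auto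
      then show ?thesis ..
    next
      case 2
      then have "FW_eq dual N L s1 s3"
        using s proc_mem steps \<eta> FW_eq_step by auto
      then show ?thesis ..
    qed
  next
    case mem_proc
    \<comment> \<open>The two moves are exactly the halves of a synchronisation on \<eta>.\<close>
    then show ?thesis using s \<eta> by (auto intro: FW_trans.sync)
  next
    case mem_mem
    then have MO: "M \<in> MO N" "M2 \<in> MO N" "M3 \<in> MO N" by (auto dest: MO_trans_in_MO)
    \<comment> \<open>A removal and an insertion cancel; two removals or two insertions change the
      buffer by a dual pair.\<close>
    consider "M = M3"
      | "M = add_mset \<eta> (add_mset (dual \<eta>) M3)"
      | "M3 = add_mset \<eta> (add_mset (dual \<eta>) M)"
      using mem_mem dual unfolding iff by auto
    then have "FW_eq dual N L s1 s3"
    proof cases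
      case 1
      then show ?thesis using s mem_mem by simp
    next
      case 2
      then show ?thesis
        using s mem_mem MO FW_eq_dual_pair[OF dual \<eta>, of p L M3] by (simp add: FW_eq_sym)
    next
      case 3
      then show ?thesis
        using s mem_mem MO FW_eq_dual_pair[OF dual \<eta>, of p L M] by simp
    qed
    then show ?thesis ..
  qed
qed

text \<open>The buffer alone stores \<eta> and releases it again.\<close>

lemma boomerang_toFW:
  assumes dual: "\<forall>\<mu>. dual (dual \<mu>) = \<mu>"
  shows "boomerang dual N (toFW dual N L)"
  unfolding boomerang_def
proof (intro ballI)
  fix \<eta> s assume \<eta>: "\<eta> \<in> N" and "s \<in> states (toFW dual N L)"
  then obtain p M where s: "s = (p, M)" "p \<in> states L" "M \<in> MO N" by (auto simp: toFW_def)
  then have "step (toFW dual N L) s (Vis (dual \<eta>)) (p, add_mset \<eta> M) \<and>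
      step (toFW dual N L) (p, add_mset \<eta> M) (Vis \<eta>) s"
    using dual \<eta> by (auto simp: FW_trans_Vis_iff MO_trans_Vis_iff[OF dual])
  then show "\<exists>s'. step (toFW dual N L) s (Vis (dual \<eta>)) s' \<and> step (toFW dual N L) s' (Vis \<eta>) s" ..
qed

lemma N_tau_toFW:
  assumes dual: "\<forall>\<mu>. dual (dual \<mu>) = \<mu>" and wf: "wf_lts L" and confl: "N_confluence N L"
    and det: "N_determinacy (=) N L" and tau: "N_tau dual N L"
  shows "N_tau dual N (toFW dual N L)"
  unfolding N_tau_def step_toFW
proof (intro ballI allI impI, elim conjE)
  fix \<eta> s1 s2 s3
  assume \<eta>: "\<eta> \<in> N" and steps: "FW_trans dual N L s1 (Vis \<eta>) s2" "FW_trans dual N L s1 Tau s3"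
  obtain p M q M2 r M3 where s: "s1 = (p, M)" "s2 = (q, M2)" "s3 = (r, M3)"
    by (metis surj_pair)
  have in_states: "x \<in> states L" "y \<in> states L" if "step L x \<alpha> y" for x \<alpha> y
    using wf that by (auto simp: wf_lts_def)
  consider (proc_proc) "step L p (Vis \<eta>) q" "step L p Tau r" "M2 = M" "M3 = M" "M \<in> MO N"
    | (proc_sync) \<zeta> where "\<zeta> \<in> N" "step L p (Vis \<eta>) q" "M2 = M"
        "step L p (Vis (dual \<zeta>)) r" "MO_trans dual N M (Vis \<zeta>) M3"
    | (mem_proc) "q = p" "MO_trans dual N M (Vis \<eta>) M2" "step L p Tau r" "M3 = M"
    | (mem_sync) \<zeta> where "\<zeta> \<in> N" "q = p" "MO_trans dual N M (Vis \<eta>) M2"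
        "step L p (Vis (dual \<zeta>)) r" "MO_trans dual N M (Vis \<zeta>) M3"
    using steps unfolding s FW_trans_Vis_iff FW_trans_Tau_iff by blast
  then show "(\<exists>s4. FW_trans dual N L s2 Tau s4 \<and> FW_trans dual N L s3 (Vis \<eta>) s4) \<or>
      FW_trans dual N L s2 (Vis (dual \<eta>)) s3"
  proof cases
    case proc_proc
    then have "(\<exists>p4. step L q Tau p4 \<and> step L r (Vis \<eta>) p4) \<or> step L q (Vis (dual \<eta>)) r"
      using tau \<eta> unfolding N_tau_def by blast
    then show ?thesis using s proc_proc by (auto intro: FW_trans.proc)
  next
    case proc_sync
    show ?thesis
    \<comment> \<open>If the process half of the synchronisation has label \<eta>, determinacy makes
      it the given \<eta>-move. What remains is the buffer half, labelled
      \<open>dual \<eta>\<close>, and the second disjunct holds.\<close>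
    proof (cases "dual \<zeta> = \<eta>")
      case True
      then have "\<zeta> = dual \<eta>" using dual by metis
      moreover have "r = q"
        using True det \<eta> proc_sync unfolding N_determinacy_def by metis
      ultimately show ?thesis using s proc_sync in_states by (auto intro: FW_trans.mem)
    next
      case False
      then obtain p4 where "step L q (Vis (dual \<zeta>)) p4" "step L r (Vis \<eta>) p4"
        using confl \<eta> proc_sync unfolding N_confluence_def by blast
      then have "FW_trans dual N L s2 Tau (p4, M3) \<and> FW_trans dual N L s3 (Vis \<eta>) (p4, M3)"
        using s proc_sync by (auto intro: FW_trans.intros dest: MO_trans_in_MO)
      then show ?thesis by blast
    qed
  next
    case mem_proc
    then have "FW_trans dual N L s2 Tau (r, M2) \<and> FW_trans dual N L s3 (Vis \<eta>) (r, M2)"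
      using s in_states by (auto intro: FW_trans.intros dest: MO_trans_in_MO)
    then show ?thesis by blast
  next
    case mem_sync
    show ?thesis
    \<comment> \<open>If the given \<eta>-move is itself the buffer half of the synchronisation, the
      process half, labelled \<open>dual \<eta>\<close>, leads from \<open>s2\<close> to
      \<open>s3\<close>.\<close>
    proof (cases "\<eta> = \<zeta> \<and> M2 = M3")
      case True
      then show ?thesis using s mem_sync by (auto intro: FW_trans.proc dest: MO_trans_in_MO)
    next
      case False
      then obtain M4 where "MO_trans dual N M2 (Vis \<zeta>) M4" "MO_trans dual N M3 (Vis \<eta>) M4"
        using MO_trans_join[OF dual] mem_sync by metis
      then have "FW_trans dual N L s2 Tau (r, M4) \<and> FW_trans dual N L s3 (Vis \<eta>) (r, M4)"
        using s mem_sync in_states by (auto intro: FW_trans.intros)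
      then show ?thesis by blast
    qed
  qed
qed

section \<open>The case of empty \<open>N\<close>, and the conclusion\<close>

lemma isomorphic_toFW_empty: "isomorphic (toFW dual {} L) L"
proof -
  \<comment> \<open>With a single, empty buffer that cannot move or synchronise, only process moves
    are left, and \<open>fst\<close> is the isomorphism.\<close>
  have MO: "MO {} = {{#}}" by (auto simp: MO_def)
  have "FW_trans dual {} L (p, {#}) \<alpha> (q, {#}) \<longleftrightarrow> step L p \<alpha> q" for p \<alpha> q
    by (auto elim!: FW_trans.cases MO_trans.cases intro!: FW_trans.proc simp: MO)
  moreover have "bij_betw fst (states L \<times> MO {}) (states L)"
    by (auto simp: bij_betw_def inj_on_def MO)
  ultimately show ?thesis
    unfolding isomorphic_def toFW_def by (intro exI[of _ fst]) (auto simp: MO)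
qed

theorem lemma11:
  fixes dual :: "'a::countable \<Rightarrow> 'a" and N :: "'a set" and L :: "('s, 'a) lts"
  assumes "\<forall>\<mu>. dual (dual \<mu>) = \<mu>"
    and "L \<in> class_A dual (=) N"
  shows "toFW dual N L \<in> class_M dual (FW_eq dual N L) N \<and>
    (N = {} \<longrightarrow> isomorphic (toFW dual N L) L)"
proof
  show "toFW dual N L \<in> class_M dual (FW_eq dual N L) N"
    using assms unfolding class_A_def class_M_def
    by (simp add: wf_toFW N_delay_toFW N_confluence_toFW N_determinacy_toFW
        backwards_N_determinacy_toFW fwd_feedback_toFW boomerang_toFW N_tau_toFW)
  show "N = {} \<longrightarrow> isomorphic (toFW dual N L) L"
    using isomorphic_toFW_empty by blast
qed

end
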